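(* Let $R$ be a quasiorder on $U$. Then $\mathcal{RS}$ is a Stone lattice if and only if $R^{-1}\circ R=R\vee R^{-1}$.
   Context: A quasiorder is a reflexive and transitive binary relation. For $x\in U$, $R(x)=\{y\in U\mid x\,R\,y\}$. For $X\subseteq U$, $X^{\blacktriangledown}=\{x\in U\mid R(x)\subseteq X\}$ and $X^{\blacktriangle}=\{x\in U\mid R(x)\cap X\neq\emptyset\}$. The rough set of $X$ is $\mathcal{A}(X)=(X^{\blacktriangledown},X^{\blacktriangle})$, $RS=\{\mathcal{A}(X)\mid X\subseteq U\}$, and $\mathcal{RS}=(RS,\leq)$ with $\leq$ the coordinatewise inclusion order on pairs of sets; for a quasiorder $R$ this is a complete lattice with coordinatewise unions and intersections as joins and meets. $R^{-1}$ is the inverse relation. Composition convention: $(x,v)\in R^{-1}\circ R$ iff there is $z\in U$ with $x\,R^{-1}\,z$ and $z\,R\,v$ (i.e. $z\,R\,x$ and $z\,R\,v$). $R\vee R^{-1}$ is the join of $R$ and $R^{-1}$ in the lattice of all quasiorders on $U$ ordered by inclusion; it equals the transitive closure of $R\cup R^{-1}$ and is the smallest equivalence containing $R$. In a lattice with least element $0$, the pseudocomplement $x^*$ of $x$ is the element with $x\wedge x^*=0$ such that $x\wedge a=0$ implies $a\leq x^*$. A Stone lattice is a pseudocomplemented bounded distributive lattice (every element has a pseudocomplement) in which $x^*\vee x^{**}=1$ for all elements $x$. *)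

theory Defs
  imports "HOL-Algebra.Complete_Lattice"
begin

text \<open>
  A quasiorder on \<open>U\<close> is a relation \<open>R\<close> with \<^term>\<open>preorder_on U R\<close>, which includes
  \<open>R \<subseteq> U \<times> U\<close>; hence \<open>R(x)\<close> is the image \<open>R `` {x}\<close>.
\<close>

section \<open>Rough sets\<close>

definition lower_approx :: "'a set \<Rightarrow> ('a \<times> 'a) set \<Rightarrow> 'a set \<Rightarrow> 'a set" where
  "lower_approx U R X = {x \<in> U. R `` {x} \<subseteq> X}"

definition upper_approx :: "'a set \<Rightarrow> ('a \<times> 'a) set \<Rightarrow> 'a set \<Rightarrow> 'a set" where
  "upper_approx U R X = {x \<in> U. R `` {x} \<inter> X \<noteq> {}}"

definition rough_set :: "'a set \<Rightarrow> ('a \<times> 'a) set \<Rightarrow> 'a set \<Rightarrow> 'a set \<times> 'a set" where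
  "rough_set U R X = (lower_approx U R X, upper_approx U R X)"

definition RS_order :: "'a set \<Rightarrow> ('a \<times> 'a) set \<Rightarrow> ('a set \<times> 'a set) gorder" where
  "RS_order U R =
    \<lparr>carrier = rough_set U R ` Pow U,
     eq = (=),
     le = (\<lambda>p q. fst p \<subseteq> fst q \<and> snd p \<subseteq> snd q)\<rparr>"

lemma RS_order_partial_order: "partial_order (RS_order U R)"
  by unfold_locales (auto simp: RS_order_def rough_set_def)

section \<open>The lattice of quasiorders\<close>

definition quasiorders :: "'a set \<Rightarrow> ('a \<times> 'a) set gorder" where
  "quasiorders U = \<lparr>carrier = {R. preorder_on U R}, eq = (=), le = (\<subseteq>)\<rparr>"

lemma quasiorders_partial_order: "partial_order (quasiorders U)"
  by unfold_locales (auto simp: quasiorders_def)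

lemma quasiorders_complete_lattice: "complete_lattice (quasiorders U)"
proof (rule partial_order.complete_lattice_criterion1[OF quasiorders_partial_order])
  have "preorder_on U (U \<times> U)"
    by (auto simp: preorder_on_def refl_on_def trans_def)
  then have "greatest (quasiorders U) (U \<times> U) (carrier (quasiorders U))"
    by (auto simp: greatest_def quasiorders_def preorder_on_def)
  then show "\<exists>g. greatest (quasiorders U) g (carrier (quasiorders U))" ..
next
  fix A :: "('a \<times> 'a) set set"
  assume A: "A \<subseteq> carrier (quasiorders U)" "A \<noteq> {}"
  then have A': "S \<subseteq> U \<times> U" "refl_on U S" "trans S" if "S \<in> A" for S
    using that by (auto simp: quasiorders_def preorder_on_def)
  have "preorder_on U (\<Inter>A)"
    unfolding preorder_on_def
  proof (intro conjI)
    show "\<Inter>A \<subseteq> U \<times> U"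
      using A(2) A'(1) by blast
    show "refl_on U (\<Inter>A)"
      using A'(2) by (simp add: refl_on_def)
    show "trans (\<Inter>A)"
      by (rule transI) (meson A'(3) InterE InterI transD)
  qed
  then have "greatest (quasiorders U) (\<Inter>A) (Lower (quasiorders U) A)"
    using A by (auto simp: greatest_def Lower_def quasiorders_def)
  then show "\<exists>i. greatest (quasiorders U) i (Lower (quasiorders U) A)" ..
qed

lemma quasiorders_join_converse:
  assumes "preorder_on U R"
  shows "R \<squnion>\<^bsub>quasiorders U\<^esub> R\<inverse> = (R \<union> R\<inverse>)\<^sup>+"
proof -
  interpret L: complete_lattice "quasiorders U"
    by (rule quasiorders_complete_lattice)
  have R: "R \<subseteq> U \<times> U" "refl_on U R"
    using assms by (auto simp: preorder_on_def)
  have T: "preorder_on U ((R \<union> R\<inverse>)\<^sup>+)"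
    unfolding preorder_on_def
  proof (intro conjI)
    show "(R \<union> R\<inverse>)\<^sup>+ \<subseteq> U \<times> U"
      using R(1) by (intro trancl_subset_Sigma) auto
    show "refl_on U ((R \<union> R\<inverse>)\<^sup>+)"
      using R(2) by (auto simp: refl_on_def)
  qed simp
  have min: "(R \<union> R\<inverse>)\<^sup>+ \<subseteq> S" if "preorder_on U S" "R \<subseteq> S" "R\<inverse> \<subseteq> S" for S
    using that trancl_mono_subset[of "R \<union> R\<inverse>" S] trancl_id[of S]
    by (simp add: preorder_on_def)
  have "least (quasiorders U) ((R \<union> R\<inverse>)\<^sup>+) (Upper (quasiorders U) {R, R\<inverse>})"
    using assms T min
    by (auto simp: least_def Upper_def quasiorders_def)
  moreover have "least (quasiorders U) (R \<squnion>\<^bsub>quasiorders U\<^esub> R\<inverse>)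
      (Upper (quasiorders U) {R, R\<inverse>})"
    unfolding join_def
    using assms by (intro L.sup_lub) (auto simp: quasiorders_def)
  ultimately show ?thesis
    by (rule L.least_unique[THEN sym])
qed

section \<open>Stone lattices\<close>

definition is_pseudocomplement :: "('a, 'b) gorder_scheme \<Rightarrow> 'a \<Rightarrow> 'a \<Rightarrow> bool" where
  "is_pseudocomplement L x y \<longleftrightarrow>
    y \<in> carrier L \<and> x \<sqinter>\<^bsub>L\<^esub> y = \<bottom>\<^bsub>L\<^esub> \<and>
    (\<forall>a \<in> carrier L. x \<sqinter>\<^bsub>L\<^esub> a = \<bottom>\<^bsub>L\<^esub> \<longrightarrow> a \<sqsubseteq>\<^bsub>L\<^esub> y)"

definition pseudocomplement :: "('a, 'b) gorder_scheme \<Rightarrow> 'a \<Rightarrow> 'a" where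
  "pseudocomplement L x = (THE y. is_pseudocomplement L x y)"

locale pseudocomplemented_distrib_lattice = bounded_lattice +
  assumes meet_join_distrib:
    "\<lbrakk>x \<in> carrier L; y \<in> carrier L; z \<in> carrier L\<rbrakk> \<Longrightarrow>
      x \<sqinter> (y \<squnion> z) = (x \<sqinter> y) \<squnion> (x \<sqinter> z)"
    and pseudocomplement_exists:
    "x \<in> carrier L \<Longrightarrow> \<exists>y. is_pseudocomplement L x y"

lemma (in partial_order) is_pseudocomplement_unique:
  assumes "is_pseudocomplement L x y" "is_pseudocomplement L x z"
  shows "y = z"
  using assms by (auto simp: is_pseudocomplement_def intro: le_antisym)

lemma (in pseudocomplemented_distrib_lattice) is_pseudocomplement_pseudocomplement:
  assumes "x \<in> carrier L"
  shows "is_pseudocomplement L x (pseudocomplement L x)"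
  unfolding pseudocomplement_def
  using pseudocomplement_exists[OF assms] is_pseudocomplement_unique
  by (auto intro: theI)

locale stone_lattice = pseudocomplemented_distrib_lattice +
  assumes stone_identity:
    "x \<in> carrier L \<Longrightarrow>
      pseudocomplement L x \<squnion> pseudocomplement L (pseudocomplement L x) = \<top>"

end

theory Submission
  imports Defs
begin

text \<open>
  The lattice of rough sets becomes tractable once the pairs that occur as rough sets are known.
  For a quasiorder \<open>R\<close>, lower approximations are up-closed and upper approximations are
  down-closed, and a pair \<open>(A, B)\<close> of an up-closed and a down-closed subset of \<open>U\<close> is a rough set
  iff \<open>A \<subseteq> B\<close> and every point \<open>x \<in> B\<close> with \<open>R(x) = {x}\<close> lies in \<open>A\<close>: at such a point the two
  approximations cannot differ. The hard direction, \<open>rough_set_image_eq\<close>, has to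
  find a set whose approximations are \<open>A\<close> and \<open>B\<close>. It rests on a
  fact about transitive relations without maximal points, \<open>cofinal_split\<close>: such a relation has two
  disjoint cofinal sets.

  The description is preserved by coordinatewise unions and intersections, so these are the joins
  and meets, the lattice is distributive, and the pseudocomplement can be read off. Disjointness
  of \<open>(A, B)\<close> from \<open>(C, D)\<close> amounts to disjointness of \<open>D\<close> from \<open>B\<close>, and hence of the
  down-closed set \<open>D\<close> from the up-closure \<open>\<up>B\<close>. So
  \<open>(A, B)\<^sup>* = (U - \<down>\<up>B, U - \<up>B)\<close>, which depends on \<open>B\<close> only.

  The Stone identity therefore says that for every down-closed \<open>B\<close> no point lies below both
  \<open>\<up>B\<close> and \<open>\<up>(U - \<up>B)\<close>. If \<open>x\<close> were such a point, it would be linked through \<open>R \<squnion> R\<inverse>\<close> to some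
  \<open>b \<in> B\<close> and some \<open>d \<notin> \<up>B\<close>; when \<open>R\<inverse> O R\<close> is that join, \<open>b\<close> and \<open>d\<close> have a common lower bound,
  which lies in \<open>B\<close> and so forces \<open>d \<in> \<up>B\<close>. Conversely, let \<open>b\<close> and \<open>d\<close> have a common upper bound.
  For \<open>B\<close> the set of points below \<open>b\<close>, the Stone identity forces \<open>d \<in> \<up>B\<close>, since otherwise \<open>b\<close>
  would lie below both sets. So \<open>b\<close> and \<open>d\<close> have a common lower bound, that is,
  \<open>R O R\<inverse> \<subseteq> R\<inverse> O R\<close>, and this inclusion is equivalent to \<open>R\<inverse> O R\<close> being the join.
\<close>

section \<open>Splitting a transitive relation into two cofinal parts\<close>

text \<open>
  A set of points coloured with \<open>True\<close> or \<open>False\<close>, no point receiving both colours, in which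
  every point sees a point of the other colour. Coding the two colour classes as one set of pairs
  lets Zorn's lemma for inclusion apply directly.
\<close>

definition alternating :: "('a \<times> 'a) set \<Rightarrow> ('a \<times> bool) set \<Rightarrow> bool" where
  "alternating R W \<longleftrightarrow> (\<forall>(x, c) \<in> W. (x, \<not> c) \<notin> W \<and> (\<exists>y. (x, y) \<in> R \<and> (y, \<not> c) \<in> W))"

text \<open>
  Two distinct points below each other can be given different colours. If there are none, a path
  with distinct consecutive points never repeats a point, and its points are coloured by
  the parity of their index.
\<close>

lemma alternating_exists:
  assumes "trans R" "q \<in> Q"
    and next_ex: "\<And>x. x \<in> Q \<Longrightarrow> \<exists>y \<in> Q. (x, y) \<in> R \<and> y \<noteq> x"
  shows "\<exists>W. W \<noteq> {} \<and> fst ` W \<subseteq> Q \<and> alternating R W"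
proof (cases "\<exists>v \<in> Q. \<exists>w \<in> Q. v \<noteq> w \<and> (v, w) \<in> R \<and> (w, v) \<in> R")
  case True
  then obtain v w where "v \<in> Q" "w \<in> Q" "v \<noteq> w" "(v, w) \<in> R" "(w, v) \<in> R"
    by blast
  then show ?thesis
    by (intro exI[of _ "{(v, True), (w, False)}"]) (auto simp: alternating_def)
next
  case no_cycle: False
  have "\<exists>f. \<forall>n. f n \<in> Q \<and> (f n, f (Suc n)) \<in> R \<and> f (Suc n) \<noteq> f n"
    using dependent_nat_choice[of "\<lambda>_ x. x \<in> Q" "\<lambda>_ x y. (x, y) \<in> R \<and> y \<noteq> x"]
      assms(2) next_ex by blast
  then obtain f :: "nat \<Rightarrow> 'a" where
    f: "\<And>n. f n \<in> Q" "\<And>n. (f n, f (Suc n)) \<in> R" "\<And>n. f (Suc n) \<noteq> f n"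
    by blast
  have above: "(f m, f (Suc (m + k))) \<in> R" for m k
    by (induction k) (use f(2) \<open>trans R\<close> in \<open>auto intro: transD\<close>)
  have neq: "f m \<noteq> f (Suc (m + k))" for m k
  proof
    assume eq: "f m = f (Suc (m + k))"
    then have "k \<noteq> 0"
      using f(3)[of m] by (cases k) auto
    then have "(f (Suc m), f m) \<in> R"
      using above[of "Suc m" "k - 1"] eq by simp
    then show False
      using no_cycle f by metis
  qed
  have inj: "m = n" if "f m = f n" for m n
    using that neq less_imp_Suc_add by (metis linorder_neqE_nat)
  define W where "W = range (\<lambda>n. (f n, even n))"
  have "alternating R W"
    unfolding alternating_def
  proof clarify
    fix x c assume "(x, c) \<in> W"
    then obtain n where n: "x = f n" "c = even n"
      by (auto simp: W_def)
    have "(x, \<not> c) \<notin> W"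
      using inj n by (auto simp: W_def)
    moreover have "(f (Suc n), \<not> c) \<in> W"
      using n by (auto simp: W_def intro!: image_eqI[of _ _ "Suc n"])
    ultimately show "(x, \<not> c) \<notin> W \<and> (\<exists>y. (x, y) \<in> R \<and> (y, \<not> c) \<in> W)"
      using f(2) n by blast
  qed
  then show ?thesis
    using f(1) by (intro exI[of _ W]) (auto simp: W_def)
qed

text \<open>
  For a maximal alternating colouring within \<open>P\<close>, every point of \<open>P\<close> sees a coloured one:
  otherwise the points above it are uncoloured and carry an alternating colouring of their own,
  which could be added. A point that sees one colour also sees the other by transitivity.
\<close>

lemma cofinal_split:
  assumes "trans R"
    and next_ex: "\<And>x. x \<in> P \<Longrightarrow> \<exists>y \<in> P. (x, y) \<in> R \<and> y \<noteq> x"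
  shows "\<exists>Y \<subseteq> P. \<forall>x \<in> P. R `` {x} \<inter> Y \<noteq> {} \<and> R `` {x} \<inter> (P - Y) \<noteq> {}"
proof -
  define F where "F = {W. fst ` W \<subseteq> P \<and> alternating R W}"
  have "\<exists>W \<in> F. \<forall>V \<in> F. W \<subseteq> V \<longrightarrow> V = W"
  proof (rule Zorn_Lemma, rule ballI)
    fix C assume C: "C \<in> chains F"
    have in_F: "V \<in> F" if "V \<in> C" for V
      using C that by (auto simp: chains_def)
    have "alternating R (\<Union>C)"
      unfolding alternating_def
    proof clarify
      fix x c V assume V: "V \<in> C" "(x, c) \<in> V"
      have "(x, \<not> c) \<notin> V'" if "V' \<in> C" for V'
      proof
        assume "(x, \<not> c) \<in> V'"
        moreover have "V \<subseteq> V' \<or> V' \<subseteq> V"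
          using chainsD[OF C] V that by blast
        moreover have "alternating R V" "alternating R V'"
          using in_F V(1) that by (auto simp: F_def)
        ultimately show False
          using V(2) by (fastforce simp: alternating_def)
      qed
      moreover have "\<exists>y. (x, y) \<in> R \<and> (y, \<not> c) \<in> V"
        using in_F[OF V(1)] V(2) by (fastforce simp: F_def alternating_def)
      ultimately show "(x, \<not> c) \<notin> \<Union>C \<and> (\<exists>y. (x, y) \<in> R \<and> (y, \<not> c) \<in> \<Union>C)"
        using V(1) by blast
    qed
    then show "\<Union>C \<in> F"
      using in_F by (force simp: F_def)
  qed
  then obtain W where "W \<in> F"
    and maximal: "\<And>V. V \<in> F \<Longrightarrow> W \<subseteq> V \<Longrightarrow> V = W"
    by blast
  then have W: "fst ` W \<subseteq> P" "alternating R W"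
    by (simp_all add: F_def)
  have sees: "\<exists>y c. (x, y) \<in> R \<and> (y, c) \<in> W" if "x \<in> P" for x
  proof (rule ccontr)
    assume unseen: "\<not> ?thesis"
    define Q where "Q = {y \<in> P. (x, y) \<in> R}"
    obtain q where "q \<in> Q"
      using next_ex[OF \<open>x \<in> P\<close>] by (auto simp: Q_def)
    moreover have "\<exists>z \<in> Q. (y, z) \<in> R \<and> z \<noteq> y" if "y \<in> Q" for y
      using that next_ex[of y] \<open>trans R\<close> by (auto simp: Q_def dest: transD)
    ultimately obtain V where V: "V \<noteq> {}" "fst ` V \<subseteq> Q" "alternating R V"
      using alternating_exists[OF \<open>trans R\<close>] by metis
    have fresh: "(y, c') \<notin> W" if "(y, c) \<in> V" for y c c'
      using that V(2) unseen by (fastforce simp: Q_def)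
    have "alternating R (W \<union> V)"
      using W(2) V(3) fresh unfolding alternating_def by fast
    moreover have "fst ` (W \<union> V) \<subseteq> P"
      using W(1) V(2) by (auto simp: Q_def)
    ultimately have "W \<union> V = W"
      by (intro maximal) (auto simp: F_def)
    then show False
      using V(1) fresh by fast
  qed
  have both: "\<exists>y. (x, y) \<in> R \<and> (y, c) \<in> W" if "x \<in> P" for x c
  proof -
    obtain y c' where y: "(x, y) \<in> R" "(y, c') \<in> W"
      using sees[OF \<open>x \<in> P\<close>] by blast
    show ?thesis
    proof (cases "c' = c")
      case True
      then show ?thesis
        using y by blast
    next
      case False
      then have "c = (\<not> c')"
        by simp
      moreover obtain z where "(y, z) \<in> R" "(z, \<not> c') \<in> W"
        using W(2) y(2) unfolding alternating_def by fast
      moreover from this have "(x, z) \<in> R"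
        using y(1) \<open>trans R\<close> by (blast dest: transD)
      ultimately show ?thesis
        by blast
    qed
  qed
  define Y where "Y = {x. (x, True) \<in> W}"
  have false_class: "y \<in> P - Y" if "(y, False) \<in> W" for y
    using that W by (force simp: Y_def alternating_def)
  have "Y \<subseteq> P"
    using W(1) by (force simp: Y_def)
  moreover have "R `` {x} \<inter> Y \<noteq> {} \<and> R `` {x} \<inter> (P - Y) \<noteq> {}" if "x \<in> P" for x
    using both[OF that, of True] both[OF that, of False] false_class
    unfolding Y_def by blast
  ultimately show ?thesis
    by blast
qed

section \<open>The pairs that are rough sets\<close>

definition rough_pairs :: "'a set \<Rightarrow> ('a \<times> 'a) set \<Rightarrow> ('a set \<times> 'a set) set" where
  "rough_pairs U R = {(A, B). A \<subseteq> B \<and> B \<subseteq> U \<and> R `` A \<subseteq> A \<and> R\<inverse> `` B \<subseteq> B \<and>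
    (\<forall>x \<in> B. R `` {x} = {x} \<longrightarrow> x \<in> A)}"

lemma preorder_onD:
  assumes "preorder_on U R"
  shows "trans R" and "x \<in> U \<Longrightarrow> (x, x) \<in> R" and "(x, y) \<in> R \<Longrightarrow> x \<in> U \<and> y \<in> U"
  using assms by (auto simp: preorder_on_def refl_on_def)

lemma rough_set_in_rough_pairs:
  assumes "preorder_on U R" "X \<subseteq> U"
  shows "rough_set U R X \<in> rough_pairs U R"
proof -
  note R = preorder_onD[OF assms(1)]
  have "lower_approx U R X \<subseteq> upper_approx U R X"
    using R(2) unfolding lower_approx_def upper_approx_def by blast
  moreover have "upper_approx U R X \<subseteq> U"
    by (auto simp: upper_approx_def)
  moreover have "R `` lower_approx U R X \<subseteq> lower_approx U R X"
    using R(3) transD[OF R(1)] unfolding lower_approx_def by blast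
  moreover have "R\<inverse> `` upper_approx U R X \<subseteq> upper_approx U R X"
    using R(3) transD[OF R(1)] unfolding upper_approx_def by blast
  moreover have "x \<in> lower_approx U R X" if "x \<in> upper_approx U R X" "R `` {x} = {x}" for x
    using that by (auto simp: lower_approx_def upper_approx_def)
  ultimately show ?thesis
    by (simp add: rough_pairs_def rough_set_def)
qed

text \<open>
  The set sought is \<open>A\<close> together with some points of \<open>D = B - A\<close>, chosen such that a point of \<open>D\<close>
  sees a chosen point unless it sees \<open>A\<close>, and sees an unchosen point of \<open>D\<close> unless it sees the
  outside of \<open>B\<close>. Let \<open>M\<close> be the points of \<open>D\<close> that see nothing else in \<open>D\<close>. Below \<open>M\<close> it
  suffices to decide about the points \<open>m \<in> M\<close>: as \<open>R(m) \<noteq> {m}\<close>, the point \<open>m\<close> sees \<open>A\<close> or the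
  outside of \<open>B\<close>, and it is chosen exactly when it does not see \<open>A\<close>. The points that are not
  below \<open>M\<close> are split into two cofinal parts.
\<close>

lemma rough_pair_is_rough_set:
  assumes pre: "preorder_on U R" and AB: "(A, B) \<in> rough_pairs U R"
  shows "(A, B) \<in> rough_set U R ` Pow U"
proof -
  note R = preorder_onD[OF pre]
  have "A \<subseteq> B" "B \<subseteq> U"
    and up: "\<And>x y. x \<in> A \<Longrightarrow> (x, y) \<in> R \<Longrightarrow> y \<in> A"
    and down: "\<And>x y. y \<in> B \<Longrightarrow> (x, y) \<in> R \<Longrightarrow> x \<in> B"
    and single: "\<And>x. x \<in> B \<Longrightarrow> R `` {x} = {x} \<Longrightarrow> x \<in> A"
    using AB by (auto simp: rough_pairs_def)
  define D where "D = B - A"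
  define M where "M = {x \<in> D. R `` {x} \<inter> D = {x}}"
  define P where "P = {x \<in> D. R `` {x} \<inter> M = {}}"
  have "\<exists>y \<in> P. (x, y) \<in> R \<and> y \<noteq> x" if "x \<in> P" for x
  proof -
    have x: "x \<in> D" "(x, x) \<in> R"
      using that R(2) \<open>B \<subseteq> U\<close> by (auto simp: P_def D_def)
    moreover from x(2) have "x \<notin> M"
      using that by (auto simp: P_def)
    ultimately obtain y where "y \<in> D" "(x, y) \<in> R" "y \<noteq> x"
      by (auto simp: M_def)
    moreover from this have "y \<in> P"
      using that R(1) by (auto simp: P_def dest: transD)
    ultimately show ?thesis
      by blast
  qed
  then obtain Y where Y: "Y \<subseteq> P"
    and split: "\<And>x. x \<in> P \<Longrightarrow> R `` {x} \<inter> Y \<noteq> {} \<and> R `` {x} \<inter> (P - Y) \<noteq> {}"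
    using cofinal_split[OF R(1), of P] by metis
  define X where "X = A \<union> Y \<union> {m \<in> M. R `` {m} \<inter> A = {}}"
  have "M \<subseteq> D" "P \<subseteq> D"
    by (auto simp: M_def P_def)
  have "M \<inter> P = {}"
    using R(2) \<open>B \<subseteq> U\<close> by (force simp: M_def P_def D_def)
  have "X \<subseteq> B"
    using \<open>A \<subseteq> B\<close> \<open>M \<subseteq> D\<close> \<open>P \<subseteq> D\<close> Y by (auto simp: X_def D_def)
  have lower: "\<not> R `` {x} \<subseteq> X" if "x \<in> D" for x
  proof (cases "x \<in> P")
    case True
    then obtain y where "(x, y) \<in> R" "y \<in> P" "y \<notin> Y"
      using split by blast
    then show ?thesis
      using \<open>M \<inter> P = {}\<close> \<open>P \<subseteq> D\<close> by (auto simp: X_def D_def)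
  next
    case False
    then obtain m where m: "(x, m) \<in> R" "m \<in> M"
      using \<open>x \<in> D\<close> by (auto simp: P_def)
    then have "m \<in> B" "m \<notin> A" "R `` {m} \<inter> D = {m}"
      by (auto simp: M_def D_def)
    show ?thesis
    proof
      assume sub: "R `` {x} \<subseteq> X"
      then have "R `` {m} \<inter> A = {}"
        using m \<open>M \<inter> P = {}\<close> Y \<open>m \<notin> A\<close> by (auto simp: X_def)
      moreover have "R `` {m} \<subseteq> B"
        using m(1) sub \<open>X \<subseteq> B\<close> R(1) by (auto dest: transD)
      ultimately have "R `` {m} = {m}"
        using \<open>R `` {m} \<inter> D = {m}\<close> by (auto simp: D_def)
      then show False
        using single \<open>m \<in> B\<close> \<open>m \<notin> A\<close> by blast
    qed
  qed
  have upper: "R `` {x} \<inter> X \<noteq> {}" if "x \<in> B" for x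
  proof -
    consider "x \<in> A" | "x \<in> P" | "x \<in> D" "x \<notin> P"
      using \<open>x \<in> B\<close> by (auto simp: D_def)
    then show ?thesis
    proof cases
      case 1
      then show ?thesis
        using R(2) that \<open>B \<subseteq> U\<close> by (auto simp: X_def)
    next
      case 2
      then show ?thesis
        using split[OF 2] by (auto simp: X_def)
    next
      case 3
      then obtain m where m: "(x, m) \<in> R" "m \<in> M"
        by (auto simp: P_def)
      then show ?thesis
      proof (cases "R `` {m} \<inter> A = {}")
        case True
        then show ?thesis
          using m by (auto simp: X_def)
      next
        case False
        then show ?thesis
          using m(1) R(1) by (auto simp: X_def dest: transD)
      qed
    qed
  qed
  have "lower_approx U R X = A"
  proof (intro equalityI subsetI)
    fix x assume x: "x \<in> lower_approx U R X"
    then have "x \<in> B"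
      using R(2) \<open>X \<subseteq> B\<close> by (auto simp: lower_approx_def)
    then show "x \<in> A"
      using lower[of x] x by (auto simp: lower_approx_def D_def)
  next
    fix x assume "x \<in> A"
    then show "x \<in> lower_approx U R X"
      using up \<open>A \<subseteq> B\<close> \<open>B \<subseteq> U\<close> by (auto simp: lower_approx_def X_def)
  qed
  moreover have "upper_approx U R X = B"
    using upper down \<open>X \<subseteq> B\<close> \<open>B \<subseteq> U\<close> by (auto simp: upper_approx_def)
  ultimately show ?thesis
    using \<open>X \<subseteq> B\<close> \<open>B \<subseteq> U\<close> by (auto simp: rough_set_def intro!: image_eqI[of _ _ X])
qed

lemma rough_set_image_eq:
  assumes "preorder_on U R"
  shows "rough_set U R ` Pow U = rough_pairs U R"
  using rough_set_in_rough_pairs[OF assms] rough_pair_is_rough_set[OF assms] by auto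

section \<open>The lattice operations on rough sets\<close>

lemma RS_simps:
  assumes "preorder_on U R"
  shows "carrier (RS_order U R) = rough_pairs U R"
    and "p \<sqsubseteq>\<^bsub>RS_order U R\<^esub> q \<longleftrightarrow> fst p \<subseteq> fst q \<and> snd p \<subseteq> snd q"
  using rough_set_image_eq[OF assms] by (simp_all add: RS_order_def)

lemma rough_pairs_closed:
  assumes "(A, B) \<in> rough_pairs U R" "(C, D) \<in> rough_pairs U R"
  shows "(A \<union> C, B \<union> D) \<in> rough_pairs U R" "(A \<inter> C, B \<inter> D) \<in> rough_pairs U R"
  using assms unfolding rough_pairs_def by auto

lemma RS_sup:
  assumes "preorder_on U R" "(A, B) \<in> rough_pairs U R" "(C, D) \<in> rough_pairs U R"
  shows "least (RS_order U R) (A \<union> C, B \<union> D) (Upper (RS_order U R) {(A, B), (C, D)})"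
  using assms rough_pairs_closed[OF assms(2,3)]
  by (auto simp: least_def Upper_def RS_simps)

lemma RS_inf:
  assumes "preorder_on U R" "(A, B) \<in> rough_pairs U R" "(C, D) \<in> rough_pairs U R"
  shows "greatest (RS_order U R) (A \<inter> C, B \<inter> D) (Lower (RS_order U R) {(A, B), (C, D)})"
  using assms rough_pairs_closed[OF assms(2,3)]
  by (auto simp: greatest_def Lower_def RS_simps)

lemma RS_least:
  assumes "preorder_on U R"
  shows "least (RS_order U R) ({}, {}) (carrier (RS_order U R))"
  using assms by (auto simp: least_def RS_simps rough_pairs_def)

lemma RS_greatest:
  assumes "preorder_on U R"
  shows "greatest (RS_order U R) (U, U) (carrier (RS_order U R))"
  using assms preorder_onD[OF assms] by (auto simp: greatest_def RS_simps rough_pairs_def)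

lemma RS_bounded_lattice:
  assumes "preorder_on U R"
  shows "bounded_lattice (RS_order U R)"
proof -
  interpret partial_order "RS_order U R"
    by (rule RS_order_partial_order)
  show ?thesis
  proof unfold_locales
    fix x y assume "x \<in> carrier (RS_order U R)" "y \<in> carrier (RS_order U R)"
    then have "(fst x, snd x) \<in> rough_pairs U R" "(fst y, snd y) \<in> rough_pairs U R"
      by (simp_all add: RS_simps[OF assms])
    from RS_sup[OF assms this] RS_inf[OF assms this]
    show "\<exists>s. least (RS_order U R) s (Upper (RS_order U R) {x, y})"
      "\<exists>s. greatest (RS_order U R) s (Lower (RS_order U R) {x, y})"
      by auto
  qed (rule exI, rule RS_least[OF assms], rule exI, rule RS_greatest[OF assms])
qed

lemma RS_operations:
  assumes "preorder_on U R"
  shows RS_bottom: "\<bottom>\<^bsub>RS_order U R\<^esub> = ({}, {})"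
    and RS_top: "\<top>\<^bsub>RS_order U R\<^esub> = (U, U)"
    and RS_join: "\<lbrakk>(A, B) \<in> rough_pairs U R; (C, D) \<in> rough_pairs U R\<rbrakk> \<Longrightarrow>
      (A, B) \<squnion>\<^bsub>RS_order U R\<^esub> (C, D) = (A \<union> C, B \<union> D)"
    and RS_meet: "\<lbrakk>(A, B) \<in> rough_pairs U R; (C, D) \<in> rough_pairs U R\<rbrakk> \<Longrightarrow>
      (A, B) \<sqinter>\<^bsub>RS_order U R\<^esub> (C, D) = (A \<inter> C, B \<inter> D)"
proof -
  interpret bounded_lattice "RS_order U R"
    by (rule RS_bounded_lattice[OF assms])
  show "\<bottom>\<^bsub>RS_order U R\<^esub> = ({}, {})"
    by (rule least_unique[OF bottom_least RS_least[OF assms]])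
  show "\<top>\<^bsub>RS_order U R\<^esub> = (U, U)"
    by (rule greatest_unique[OF top_greatest RS_greatest[OF assms]])
  assume P: "(A, B) \<in> rough_pairs U R" "(C, D) \<in> rough_pairs U R"
  have "least (RS_order U R) ((A, B) \<squnion>\<^bsub>RS_order U R\<^esub> (C, D))
      (Upper (RS_order U R) {(A, B), (C, D)})"
    unfolding join_def by (rule sup_of_two_least) (use P in \<open>simp_all add: RS_simps[OF assms]\<close>)
  then show "(A, B) \<squnion>\<^bsub>RS_order U R\<^esub> (C, D) = (A \<union> C, B \<union> D)"
    by (rule least_unique[OF _ RS_sup[OF assms P]])
  have "greatest (RS_order U R) ((A, B) \<sqinter>\<^bsub>RS_order U R\<^esub> (C, D))
      (Lower (RS_order U R) {(A, B), (C, D)})"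
    unfolding meet_def by (rule inf_of_two_greatest) (use P in \<open>simp_all add: RS_simps[OF assms]\<close>)
  then show "(A, B) \<sqinter>\<^bsub>RS_order U R\<^esub> (C, D) = (A \<inter> C, B \<inter> D)"
    by (rule greatest_unique[OF _ RS_inf[OF assms P]])
qed

section \<open>Pseudocomplements of rough sets\<close>

definition rough_compl :: "'a set \<Rightarrow> ('a \<times> 'a) set \<Rightarrow> 'a set \<Rightarrow> 'a set \<times> 'a set" where
  "rough_compl U R B = (U - R\<inverse> `` (R `` B), U - R `` B)"

lemma rough_compl_in_rough_pairs:
  assumes "preorder_on U R"
  shows "rough_compl U R B \<in> rough_pairs U R"
proof -
  note R = preorder_onD[OF assms]
  have "U - R\<inverse> `` (R `` B) \<subseteq> U - R `` B"
    using R(2) by blast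
  moreover have "R `` (U - R\<inverse> `` (R `` B)) \<subseteq> U - R\<inverse> `` (R `` B)"
    using R(3) transD[OF R(1)] by blast
  moreover have "R\<inverse> `` (U - R `` B) \<subseteq> U - R `` B"
    using R(3) transD[OF R(1)] by blast
  moreover have "x \<in> R `` B" if "x \<in> R\<inverse> `` (R `` B)" "R `` {x} = {x}" for x
  proof -
    obtain y where "(x, y) \<in> R" "y \<in> R `` B"
      using \<open>x \<in> R\<inverse> `` (R `` B)\<close> by blast
    moreover from this have "y = x"
      using \<open>R `` {x} = {x}\<close> by blast
    ultimately show ?thesis
      by simp
  qed
  then have "\<forall>x \<in> U - R `` B. R `` {x} = {x} \<longrightarrow> x \<in> U - R\<inverse> `` (R `` B)"
    by blast
  ultimately show ?thesis
    by (simp only: rough_pairs_def rough_compl_def) simp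
qed

lemma is_pseudocomplement_rough_compl:
  assumes pre: "preorder_on U R" and AB: "(A, B) \<in> rough_pairs U R"
  shows "is_pseudocomplement (RS_order U R) (A, B) (rough_compl U R B)"
proof -
  note R = preorder_onD[OF pre]
  have "A \<subseteq> B" "B \<subseteq> U" "B \<subseteq> R `` B"
    using AB R(2) by (auto simp: rough_pairs_def)
  then have "B \<subseteq> R\<inverse> `` (R `` B)"
    using R(2) by blast
  have meet: "(A, B) \<sqinter>\<^bsub>RS_order U R\<^esub> rough_compl U R B = \<bottom>\<^bsub>RS_order U R\<^esub>"
    using RS_meet[OF pre AB] rough_compl_in_rough_pairs[OF pre, of B] \<open>A \<subseteq> B\<close> \<open>B \<subseteq> R `` B\<close>
      \<open>B \<subseteq> R\<inverse> `` (R `` B)\<close>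
    by (auto simp: RS_bottom[OF pre] rough_compl_def)
  have "(C, D) \<sqsubseteq>\<^bsub>RS_order U R\<^esub> rough_compl U R B"
    if CD: "(C, D) \<in> rough_pairs U R"
      and "(A, B) \<sqinter>\<^bsub>RS_order U R\<^esub> (C, D) = \<bottom>\<^bsub>RS_order U R\<^esub>" for C D
  proof -
    have "B \<inter> D = {}"
      using that by (simp add: RS_meet[OF pre AB] RS_bottom[OF pre])
    moreover have "C \<subseteq> D" "D \<subseteq> U" "R `` C \<subseteq> C" "R\<inverse> `` D \<subseteq> D"
      using CD by (auto simp: rough_pairs_def)
    ultimately have "D \<subseteq> U - R `` B"
      by blast
    moreover have "C \<subseteq> U - R\<inverse> `` (R `` B)"
      using \<open>C \<subseteq> D\<close> \<open>R `` C \<subseteq> C\<close> \<open>D \<subseteq> U - R `` B\<close> by blast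
    ultimately show ?thesis
      by (simp add: rough_compl_def RS_simps[OF pre])
  qed
  then show ?thesis
    unfolding is_pseudocomplement_def RS_simps(1)[OF pre]
    using meet rough_compl_in_rough_pairs[OF pre] by auto
qed

lemma RS_pseudocomplemented:
  assumes "preorder_on U R"
  shows "pseudocomplemented_distrib_lattice (RS_order U R)"
proof -
  interpret bounded_lattice "RS_order U R"
    by (rule RS_bounded_lattice[OF assms])
  show ?thesis
  proof unfold_locales
    fix x y z
    assume "x \<in> carrier (RS_order U R)" "y \<in> carrier (RS_order U R)" "z \<in> carrier (RS_order U R)"
    then show "x \<sqinter>\<^bsub>RS_order U R\<^esub> (y \<squnion>\<^bsub>RS_order U R\<^esub> z) =
        (x \<sqinter>\<^bsub>RS_order U R\<^esub> y) \<squnion>\<^bsub>RS_order U R\<^esub> (x \<sqinter>\<^bsub>RS_order U R\<^esub> z)"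
      by (cases x; cases y; cases z)
        (simp add: RS_simps[OF assms] RS_join[OF assms] RS_meet[OF assms]
          rough_pairs_closed Int_Un_distrib)
  next
    fix x assume "x \<in> carrier (RS_order U R)"
    then show "\<exists>y. is_pseudocomplement (RS_order U R) x y"
      using is_pseudocomplement_rough_compl[OF assms, of "fst x" "snd x"]
      unfolding RS_simps(1)[OF assms] prod.collapse by blast
  qed
qed

lemma RS_pseudocomplement:
  assumes "preorder_on U R" "(A, B) \<in> rough_pairs U R"
  shows "pseudocomplement (RS_order U R) (A, B) = rough_compl U R B"
proof -
  interpret pseudocomplemented_distrib_lattice "RS_order U R"
    by (rule RS_pseudocomplemented[OF assms(1)])
  have "is_pseudocomplement (RS_order U R) (A, B) (pseudocomplement (RS_order U R) (A, B))"
    using assms by (intro is_pseudocomplement_pseudocomplement) (simp add: RS_simps)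
  then show ?thesis
    using is_pseudocomplement_rough_compl[OF assms] by (rule is_pseudocomplement_unique)
qed

section \<open>The Stone identity\<close>

text \<open>
  Only the first coordinates of \<open>x\<^sup>* \<squnion> x\<^sup>*\<^sup>*\<close> matter, since they are contained in the second
  ones. Every down-closed \<open>B\<close> occurs as a second coordinate of a rough set, namely of \<open>(B', B)\<close>
  for the lower approximation \<open>B'\<close> of \<open>B\<close>.
\<close>

lemma stone_lattice_RS_iff:
  assumes pre: "preorder_on U R"
  shows "stone_lattice (RS_order U R) \<longleftrightarrow>
    (\<forall>B \<subseteq> U. R\<inverse> `` B \<subseteq> B \<longrightarrow>
      R\<inverse> `` (R `` B) \<inter> R\<inverse> `` (R `` (U - R `` B)) = {})"
proof -
  note R = preorder_onD[OF pre]
  interpret pseudocomplemented_distrib_lattice "RS_order U R"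
    by (rule RS_pseudocomplemented[OF pre])
  have stone_at: "pseudocomplement (RS_order U R) (A, B) \<squnion>\<^bsub>RS_order U R\<^esub>
      pseudocomplement (RS_order U R) (pseudocomplement (RS_order U R) (A, B)) =
      \<top>\<^bsub>RS_order U R\<^esub> \<longleftrightarrow> R\<inverse> `` (R `` B) \<inter> R\<inverse> `` (R `` (U - R `` B)) = {}"
    if AB: "(A, B) \<in> rough_pairs U R" for A B
  proof -
    let ?B' = "U - R `` B"
    note in_pairs = rough_compl_in_rough_pairs[OF pre]
    have "pseudocomplement (RS_order U R) (rough_compl U R B) = rough_compl U R ?B'"
      using RS_pseudocomplement[OF pre] in_pairs[of B] by (simp add: rough_compl_def)
    moreover have "rough_compl U R B \<squnion>\<^bsub>RS_order U R\<^esub> rough_compl U R ?B' =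
        ((U - R\<inverse> `` (R `` B)) \<union> (U - R\<inverse> `` (R `` ?B')), (U - R `` B) \<union> (U - R `` ?B'))"
      using RS_join[OF pre] in_pairs[of B] in_pairs[of ?B'] by (simp add: rough_compl_def)
    ultimately have "pseudocomplement (RS_order U R) (A, B) \<squnion>\<^bsub>RS_order U R\<^esub>
        pseudocomplement (RS_order U R) (pseudocomplement (RS_order U R) (A, B)) =
        \<top>\<^bsub>RS_order U R\<^esub> \<longleftrightarrow>
        (U - R\<inverse> `` (R `` B)) \<union> (U - R\<inverse> `` (R `` ?B')) = U \<and>
        (U - R `` B) \<union> (U - R `` ?B') = U"
      by (simp add: RS_pseudocomplement[OF pre AB] RS_top[OF pre])
    moreover have "V \<subseteq> R\<inverse> `` V" if "V \<subseteq> U" for V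
      using that R(2) by blast
    then have "R `` B \<subseteq> R\<inverse> `` (R `` B)" "R `` ?B' \<subseteq> R\<inverse> `` (R `` ?B')"
      using R(3) by blast+
    moreover have "R\<inverse> `` (R `` B) \<subseteq> U"
      using R(3) by blast
    ultimately show ?thesis
      by blast
  qed
  have occurs: "\<exists>A. (A, B) \<in> rough_pairs U R" if "B \<subseteq> U" "R\<inverse> `` B \<subseteq> B" for B
  proof -
    have "upper_approx U R B = B"
      using that R(2) by (auto simp: upper_approx_def)
    then show ?thesis
      using rough_set_in_rough_pairs[OF pre that(1)] by (auto simp: rough_set_def)
  qed
  have "stone_lattice (RS_order U R) \<longleftrightarrow>
      (\<forall>A B. (A, B) \<in> rough_pairs U R \<longrightarrow>
        R\<inverse> `` (R `` B) \<inter> R\<inverse> `` (R `` (U - R `` B)) = {})"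
    using pseudocomplemented_distrib_lattice_axioms stone_at
    by (auto simp: stone_lattice_def stone_lattice_axioms_def RS_simps[OF pre])
  moreover have "B \<subseteq> U \<and> R\<inverse> `` B \<subseteq> B" if "(A, B) \<in> rough_pairs U R" for A B
    using that by (simp add: rough_pairs_def)
  ultimately show ?thesis
    using occurs by meson
qed

text \<open>
  If common upper bounds yield common lower bounds, then any zigzag of \<open>R\<close> and \<open>R\<inverse>\<close> steps can be
  rearranged into one step down followed by one step up.
\<close>

lemma converse_comp_eq_join_iff:
  assumes pre: "preorder_on U R"
  shows "R\<inverse> O R = R \<squnion>\<^bsub>quasiorders U\<^esub> R\<inverse> \<longleftrightarrow> R O R\<inverse> \<subseteq> R\<inverse> O R"
proof -
  note R = preorder_onD[OF pre]
  have zigzag: "R O R\<inverse> \<subseteq> (R \<union> R\<inverse>)\<^sup>+" "R\<inverse> O R \<subseteq> (R \<union> R\<inverse>)\<^sup>+"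
    by (auto intro: trancl_into_trancl2)
  have "(R \<union> R\<inverse>)\<^sup>+ \<subseteq> R\<inverse> O R" if church_rosser: "R O R\<inverse> \<subseteq> R\<inverse> O R"
  proof (rule subrelI)
    fix x y assume "(x, y) \<in> (R \<union> R\<inverse>)\<^sup>+"
    then show "(x, y) \<in> R\<inverse> O R"
    proof induction
      case (base y)
      then show ?case
        using R(2,3) by blast
    next
      case (step y z)
      then obtain w where w: "(w, x) \<in> R" "(w, y) \<in> R"
        by blast
      show ?case
      proof (cases "(y, z) \<in> R")
        case True
        then show ?thesis
          using w R(1) by (blast dest: transD)
      next
        case False
        then have "(w, z) \<in> R O R\<inverse>"
          using step.hyps w by blast
        then show ?thesis
          using church_rosser w(1) R(1) by (blast dest: transD)
      qed
    qed
  qed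
  then show ?thesis
    unfolding quasiorders_join_converse[OF pre] using zigzag by blast
qed

theorem theorem6p4:
  fixes U :: "'a set" and R :: "('a \<times> 'a) set"
  assumes "preorder_on U R"
  shows "stone_lattice (RS_order U R) \<longleftrightarrow> R\<inverse> O R = R \<squnion>\<^bsub>quasiorders U\<^esub> R\<inverse>"
proof -
  note R = preorder_onD[OF assms]
  have "(\<forall>B \<subseteq> U. R\<inverse> `` B \<subseteq> B \<longrightarrow>
      R\<inverse> `` (R `` B) \<inter> R\<inverse> `` (R `` (U - R `` B)) = {}) \<longleftrightarrow> R O R\<inverse> \<subseteq> R\<inverse> O R"
    (is "?stone \<longleftrightarrow> ?common")
  proof
    assume stone: ?stone
    show ?common
    proof (rule subrelI)
      fix b d assume "(b, d) \<in> R O R\<inverse>"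
      then obtain y where y: "(b, y) \<in> R" "(d, y) \<in> R"
        by blast
      let ?B = "R\<inverse> `` {b}"
      have "?B \<subseteq> U" "R\<inverse> `` ?B \<subseteq> ?B"
        using R(1,3) by (auto dest: transD)
      then have disjoint: "R\<inverse> `` (R `` ?B) \<inter> R\<inverse> `` (R `` (U - R `` ?B)) = {}"
        using stone by blast
      have "b \<in> R\<inverse> `` (R `` ?B)"
        using y(1) R(2,3) by blast
      then have "d \<in> R `` ?B"
        using disjoint y R(3) by blast
      then show "(b, d) \<in> R\<inverse> O R"
        by blast
    qed
  next
    assume common: ?common
    then have join: "R\<inverse> O R = (R \<union> R\<inverse>)\<^sup>+"
      using converse_comp_eq_join_iff[OF assms] quasiorders_join_converse[OF assms] by simp
    show ?stone
    proof (intro allI impI equals0I)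
      fix B x
      assume down: "R\<inverse> `` B \<subseteq> B"
        and x: "x \<in> R\<inverse> `` (R `` B) \<inter> R\<inverse> `` (R `` (U - R `` B))"
      then obtain b d y z where "b \<in> B" "(b, y) \<in> R" "(x, y) \<in> R"
        and d: "d \<notin> R `` B" "(d, z) \<in> R" "(x, z) \<in> R"
        by blast
      then have "(b, x) \<in> R\<inverse> O R" "(x, d) \<in> R\<inverse> O R"
        using common by blast+
      then have "(b, d) \<in> R\<inverse> O R"
        unfolding join by (rule trancl_trans)
      then show False
        using down \<open>b \<in> B\<close> d(1) by blast
    qed
  qed
  then show ?thesis
    using stone_lattice_RS_iff[OF assms] converse_comp_eq_join_iff[OF assms] by simp
qed

end
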